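(* There do not exist a deterministic algorithm $\mathcal{A}$ for Learn-Median, a function $\alpha:\mathbb{N}\to\mathbb{R}_{\ge0}$ with $\alpha(k)/k\to0$ as $k\to\infty$, a function $g:\mathbb{N}\to\mathbb{R}_{\ge0}$ with $g(T)/T\to0$ as $T\to\infty$, and a function $f$ of $(k,n,\Delta)$, such that for every $k$, every finite metric space $(V,d)$ (with $n=|V|$ and aspect ratio $\Delta$), every $T$, every sequence $V_0,\dots,V_T$ of instances, and every $Y\subseteq V$ with $|Y|=k$, \[ \sum_{t=1}^T\rho(Y_t,V_t)\le\alpha(k)\sum_{t=1}^T\rho(Y,V_t)+g(T)\,f(k,n,\Delta), \] where $Y_t$ is the output of $\mathcal{A}$ at time $t$. This impossibility holds even if $\mathcal{A}$ knows the metric space $(V,d)$ upfront and may output any $k$ points of $V$ at each time.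
   Context: Learn-Median: $(V,d)$ is a finite metric space with $n$ points scaled so that $\min_{x\neq y}d(x,y)=1$, and $\Delta=\max_{x,y}d(x,y)$. A sequence of instances $V_0,\dots,V_T\subseteq V$, each with at least $k+1$ distinct points, arrives online; at each time $t\ge1$, knowing $V_0,\dots,V_{t-1}$ but not $V_t$, the algorithm outputs a set $Y_t$ of $k$ points (in the standard model $Y_t\subseteq V_0\cup\dots\cup V_{t-1}$). For a set $Y$, $D(Y,x)=\min_{y\in Y}d(x,y)$, $\mathrm{Cost}_t(Y)=\sum_{x\in V_t}D(Y,x)$, $\mathrm{OPT}_t=\min_{Y\subseteq V,|Y|=k}\mathrm{Cost}_t(Y)$, $\rho(Y,V_t)=\mathrm{Cost}_t(Y)/\mathrm{OPT}_t$. *)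

theory Defs
  imports "HOL-Analysis.Abstract_Metric_Spaces" "HOL-Library.Infinite_Typeclass"
begin

text \<open>A finite metric space with carrier \<open>V\<close>, scaled so that the least distance between distinct
  points is 1. The condition \<open>2 \<le> card V\<close> makes that minimum range over a nonempty set; it is
  automatic as soon as \<open>V\<close> contains an instance with at least \<open>k + 1 \<ge> 2\<close> points.\<close>

definition scaled_metric :: "'a set \<Rightarrow> ('a \<Rightarrow> 'a \<Rightarrow> real) \<Rightarrow> bool" where
  "scaled_metric V d \<longleftrightarrow> Metric_space V d \<and> finite V \<and> 2 \<le> card V \<and>
     Min {d x y | x y. x \<in> V \<and> y \<in> V \<and> x \<noteq> y} = 1"

definition aspect_ratio :: "'a set \<Rightarrow> ('a \<Rightarrow> 'a \<Rightarrow> real) \<Rightarrow> real" where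
  "aspect_ratio V d = Max {d x y | x y. x \<in> V \<and> y \<in> V}"

definition median_instance :: "nat \<Rightarrow> 'a set \<Rightarrow> 'a set \<Rightarrow> bool" where
  "median_instance k V X \<longleftrightarrow> X \<subseteq> V \<and> k + 1 \<le> card X"

definition set_dist :: "('a \<Rightarrow> 'a \<Rightarrow> real) \<Rightarrow> 'a set \<Rightarrow> 'a \<Rightarrow> real" where
  "set_dist d Y x = Min ((\<lambda>y. d x y) ` Y)"

definition cost :: "('a \<Rightarrow> 'a \<Rightarrow> real) \<Rightarrow> 'a set \<Rightarrow> 'a set \<Rightarrow> real" where
  "cost d X Y = (\<Sum>x\<in>X. set_dist d Y x)"

definition opt :: "nat \<Rightarrow> 'a set \<Rightarrow> ('a \<Rightarrow> 'a \<Rightarrow> real) \<Rightarrow> 'a set \<Rightarrow> real" where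
  "opt k V d X = Min (cost d X ` {Y. Y \<subseteq> V \<and> card Y = k})"

definition rho :: "nat \<Rightarrow> 'a set \<Rightarrow> ('a \<Rightarrow> 'a \<Rightarrow> real) \<Rightarrow> 'a set \<Rightarrow> 'a set \<Rightarrow> real" where
  "rho k V d Y X = cost d X Y / opt k V d X"

text \<open>A deterministic algorithm maps \<open>k\<close>, the metric space \<open>(V, d)\<close> and the list
  \<open>[V\<^sub>0, \<dots>, V\<^sub>t\<^sub>-\<^sub>1]\<close> of past instances to its output at time \<open>t\<close>. The horizon \<open>T\<close> is not an input.\<close>

type_synonym 'a learner =
  "nat \<Rightarrow> 'a set \<Rightarrow> ('a \<Rightarrow> 'a \<Rightarrow> real) \<Rightarrow> 'a set list \<Rightarrow> 'a set"

definition valid_history :: "nat \<Rightarrow> 'a set \<Rightarrow> 'a set list \<Rightarrow> bool" where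
  "valid_history k V H \<longleftrightarrow> H \<noteq> [] \<and> (\<forall>X\<in>set H. median_instance k V X)"

text \<open>The learner that knows the metric space upfront and may output any \<open>k\<close> points of it.\<close>

definition informed_learner :: "'a learner \<Rightarrow> bool" where
  "informed_learner A \<longleftrightarrow>
     (\<forall>k V d H. 1 \<le> k \<longrightarrow> scaled_metric V d \<longrightarrow> valid_history k V H \<longrightarrow>
        A k V d H \<subseteq> V \<and> card (A k V d H) = k)"

text \<open>The learner of the standard model outputs only revealed points. The second conjunct says that
  it learns about the metric space only through the distances among revealed points.\<close>

definition standard_learner :: "'a learner \<Rightarrow> bool" where
  "standard_learner A \<longleftrightarrow>
     (\<forall>k V d H. 1 \<le> k \<longrightarrow> scaled_metric V d \<longrightarrow> valid_history k V H \<longrightarrow>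
        A k V d H \<subseteq> \<Union>(set H) \<and> card (A k V d H) = k) \<and>
     (\<forall>k V d V' d' H. 1 \<le> k \<longrightarrow> scaled_metric V d \<longrightarrow> scaled_metric V' d' \<longrightarrow>
        valid_history k V H \<longrightarrow> valid_history k V' H \<longrightarrow>
        (\<forall>x\<in>\<Union>(set H). \<forall>y\<in>\<Union>(set H). d x y = d' x y) \<longrightarrow>
        A k V d H = A k V' d' H)"

definition output_at ::
  "'a learner \<Rightarrow> nat \<Rightarrow> 'a set \<Rightarrow> ('a \<Rightarrow> 'a \<Rightarrow> real) \<Rightarrow> (nat \<Rightarrow> 'a set) \<Rightarrow> nat \<Rightarrow> 'a set" where
  "output_at A k V d I t = A k V d (map I [0..<t])"

definition has_guarantee ::
  "'a learner \<Rightarrow> (nat \<Rightarrow> real) \<Rightarrow> (nat \<Rightarrow> real) \<Rightarrow> (nat \<Rightarrow> nat \<Rightarrow> real \<Rightarrow> real) \<Rightarrow> bool" where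
  "has_guarantee A \<alpha> g f \<longleftrightarrow>
     (\<forall>k V d T I Y. 1 \<le> k \<longrightarrow> scaled_metric V d \<longrightarrow>
        (\<forall>t\<le>T. median_instance k V (I t)) \<longrightarrow> Y \<subseteq> V \<longrightarrow> card Y = k \<longrightarrow>
        (\<Sum>t=1..T. rho k V d (output_at A k V d I t) (I t))
          \<le> \<alpha> k * (\<Sum>t=1..T. rho k V d Y (I t)) + g T * f k (card V) (aspect_ratio V d))"

end

theory Submission
  imports Defs "HOL-Library.Nat_Bijection"
begin

text \<open>Take \<open>k + 1\<close> clusters of \<open>k + 1\<close> points each, with distance 1 inside a cluster and distance
  \<open>k\<close> between clusters. Any \<open>k\<close> centres miss a cluster, and the adversary presents exactly that
  cluster: the optimum is 1 and the learner pays \<open>(k + 1) * k\<close> in every step. The cluster presented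
  least often appears at most \<open>T / (k + 1)\<close> times, and the comparator having one centre in each of
  the other clusters pays \<open>k\<close> whenever it does not appear, hence at most \<open>2 * k * T\<close> in total.
  Letting \<open>T\<close> tend to infinity gives \<open>\<alpha> k \<ge> (k + 1) / 2\<close>.\<close>

section \<open>Tools for learners, adaptive sequences and counting\<close>

text \<open>Revealed points lie in \<open>V\<close> because every instance does, so ruling out
  informed learners rules out the standard model as well.\<close>

lemma standard_imp_informed:
  assumes "standard_learner A"
  shows "informed_learner A"
  unfolding informed_learner_def
proof (intro allI impI)
  fix k :: nat and V :: "'a set" and d H
  assume h: "1 \<le> k" "scaled_metric V d" "valid_history k V H"
  have "A k V d H \<subseteq> \<Union>(set H)" "card (A k V d H) = k"
    using assms h unfolding standard_learner_def by blast+
  moreover have "\<Union>(set H) \<subseteq> V"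
    using h(3) by (auto simp: valid_history_def median_instance_def)
  ultimately show "A k V d H \<subseteq> V \<and> card (A k V d H) = k" by blast
qed

text \<open>This provides an adaptive adversary: each term is computed from all earlier ones. The
  lists of past terms are obtained by iterating "append the next term" from the empty list.\<close>

lemma ex_history_dependent_sequence:
  fixes nxt :: "'b list \<Rightarrow> 'b"
  shows "\<exists>I. \<forall>t. I t = nxt (map I [0..<t])"
proof -
  define hist where "hist n = ((\<lambda>H. H @ [nxt H]) ^^ n) []" for n
  have "map (\<lambda>t. nxt (hist t)) [0..<n] = hist n" for n
    by (induction n) (auto simp: hist_def)
  then show ?thesis
    by (intro exI[of _ "\<lambda>t. nxt (hist t)"]) simp
qed

text \<open>Averaging: the \<open>k + 1\<close> fibres of \<open>j\<close> partition
  \<open>S\<close>, so they cannot all exceed the mean size. The product form avoids division in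
  \<open>nat\<close>.\<close>

lemma ex_rarely_hit:
  fixes j :: "'b \<Rightarrow> nat"
  assumes "finite S" and "\<And>t. t \<in> S \<Longrightarrow> j t \<le> k"
  shows "\<exists>i\<le>k. (k + 1) * card {t \<in> S. j t = i} \<le> card S"
proof (rule ccontr)
  assume "\<not> ?thesis"
  then have less: "card S < (k + 1) * card {t \<in> S. j t = i}" if "i \<le> k" for i
    using that by (meson not_le)
  have "S = (\<Union>i\<le>k. {t \<in> S. j t = i})"
    using assms(2) by auto
  also have "card \<dots> = (\<Sum>i\<le>k. card {t \<in> S. j t = i})"
    by (rule card_UN_disjoint) (use assms(1) in auto)
  finally have "card S = (\<Sum>i\<le>k. card {t \<in> S. j t = i})" .
  then have "(\<Sum>i\<le>k. card S) = (\<Sum>i\<le>k. (k + 1) * card {t \<in> S. j t = i})"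
    by (simp add: sum.distrib sum_distrib_left)
  moreover have "(\<Sum>i\<le>k. card S) < (\<Sum>i\<le>k. (k + 1) * card {t \<in> S. j t = i})"
    by (rule sum_strict_mono) (use less in auto)
  ultimately show False by simp
qed

section \<open>The clustered space and its costs\<close>

text \<open>For \<open>M\<close> \<ge> 1 this is an ultrametric: having equal labels is an
  equivalence relation.\<close>

definition cluster_dist :: "real \<Rightarrow> ('a \<Rightarrow> nat) \<Rightarrow> 'a \<Rightarrow> 'a \<Rightarrow> real" where
  "cluster_dist M c x y = (if x = y then 0 else if c x = c y then 1 else M)"

text \<open>A cluster has \<open>k + 1\<close> points so that it is by itself an admissible
  instance, of the least size allowed.\<close>

locale clustered =
  fixes k :: nat and V :: "'a set" and c :: "'a \<Rightarrow> nat"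
  assumes k_pos: "1 \<le> k"
    and label: "x \<in> V \<Longrightarrow> c x \<le> k"
    and card_label: "i \<le> k \<Longrightarrow> card {x \<in> V. c x = i} = k + 1"
begin

definition clus :: "nat \<Rightarrow> 'a set" where
  "clus i = {x \<in> V. c x = i}"

abbreviation dist_k :: "'a \<Rightarrow> 'a \<Rightarrow> real" where
  "dist_k \<equiv> cluster_dist (real k) c"

lemma card_clus: "i \<le> k \<Longrightarrow> card (clus i) = k + 1"
  unfolding clus_def by (rule card_label)

lemma finite_clus: "i \<le> k \<Longrightarrow> finite (clus i)"
  using card_clus[of i] by (intro card_ge_0_finite) simp

lemma clus_nonempty: "i \<le> k \<Longrightarrow> clus i \<noteq> {}"
  using card_clus[of i] by auto

lemma finite_V: "finite V"
proof -
  have "V \<subseteq> (\<Union>i\<le>k. clus i)"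
    using label by (auto simp: clus_def)
  then show ?thesis
    by (rule finite_subset) (use finite_clus in auto)
qed

lemma median_instance_clus: "i \<le> k \<Longrightarrow> median_instance k V (clus i)"
  by (auto simp: median_instance_def card_clus) (auto simp: clus_def)

lemma dist_k_ge_1: "x \<noteq> y \<Longrightarrow> 1 \<le> dist_k x y"
  using k_pos by (auto simp: cluster_dist_def)

lemma scaled_metric_V: "scaled_metric V dist_k"
proof -
  have metric: "Metric_space V dist_k"
    by unfold_locales (use k_pos in \<open>auto simp: cluster_dist_def\<close>)
  \<comment> \<open>Two points of one cluster realise the minimum distance 1.\<close>
  have "2 \<le> card (clus 0)"
    using card_clus[of 0] k_pos by simp
  then obtain x y where xy: "x \<in> clus 0" "y \<in> clus 0" "x \<noteq> y"
    by (metis card_le_Suc0_iff_eq finite_clus le0 not_less_eq_eq numeral_2_eq_2)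
  have "2 \<le> card V"
    using \<open>2 \<le> card (clus 0)\<close> card_mono[OF finite_V, of "clus 0"] by (auto simp: clus_def)
  moreover have "Min {dist_k x y |x y. x \<in> V \<and> y \<in> V \<and> x \<noteq> y} = 1"
  proof (rule Min_eqI)
    have "{dist_k x y |x y. x \<in> V \<and> y \<in> V \<and> x \<noteq> y} \<subseteq> (\<lambda>(x, y). dist_k x y) ` (V \<times> V)"
      by auto
    then show "finite {dist_k x y |x y. x \<in> V \<and> y \<in> V \<and> x \<noteq> y}"
      using finite_V by (meson finite_SigmaI finite_imageI finite_subset)
  next
    have "x \<in> V" "y \<in> V" "dist_k x y = 1"
      using xy by (auto simp: clus_def cluster_dist_def)
    then show "1 \<in> {dist_k x y |x y. x \<in> V \<and> y \<in> V \<and> x \<noteq> y}"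
      using xy(3) by force
  qed (use dist_k_ge_1 in auto)
  ultimately show ?thesis
    using metric finite_V by (simp add: scaled_metric_def)
qed

lemma set_dist_self:
  assumes "finite Y" "x \<in> Y"
  shows "set_dist dist_k Y x = 0"
  unfolding set_dist_def
proof (rule Min_eqI)
  show "0 \<in> dist_k x ` Y"
    using assms(2) by (force simp: cluster_dist_def)
qed (use assms in \<open>auto simp: cluster_dist_def\<close>)

lemma set_dist_nonneg:
  assumes "finite Y" "Y \<noteq> {}"
  shows "0 \<le> set_dist dist_k Y x"
  unfolding set_dist_def using assms by (intro Min.boundedI) (auto simp: cluster_dist_def)

lemma set_dist_le:
  assumes "finite Y" "y \<in> Y"
  shows "set_dist dist_k Y x \<le> dist_k x y"
  using assms by (simp add: set_dist_def)

lemma set_dist_outside_ge_1: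
  assumes "finite Y" "Y \<noteq> {}" "x \<notin> Y"
  shows "1 \<le> set_dist dist_k Y x"
  unfolding set_dist_def using assms by (intro Min.boundedI) (auto intro!: dist_k_ge_1)

text \<open>Any \<open>k\<close> centres leave one of the \<open>k + 1\<close> points uncovered,
  which costs at least 1. Taking all points of the cluster but one as centres attains this.\<close>

lemma opt_clus:
  assumes "i \<le> k"
  shows "opt k V dist_k (clus i) = 1"
  unfolding opt_def
proof (rule Min_eqI)
  have "finite {Y. Y \<subseteq> V \<and> card Y = k}"
    using finite_V by simp
  then show "finite (cost dist_k (clus i) ` {Y. Y \<subseteq> V \<and> card Y = k})"
    by simp
next
  fix r assume "r \<in> cost dist_k (clus i) ` {Y. Y \<subseteq> V \<and> card Y = k}"
  then obtain Y where Y: "Y \<subseteq> V" "card Y = k" and r: "r = cost dist_k (clus i) Y" by auto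
  have fin: "finite Y" and ne: "Y \<noteq> {}"
    using Y finite_V finite_subset k_pos by auto
  have "\<not> clus i \<subseteq> Y"
    using card_mono[OF fin, of "clus i"] card_clus[OF assms] Y(2) by auto
  then obtain x where x: "x \<in> clus i" "x \<notin> Y" by auto
  have "1 \<le> set_dist dist_k Y x"
    using set_dist_outside_ge_1 fin ne x(2) by blast
  also have "\<dots> \<le> cost dist_k (clus i) Y"
    unfolding cost_def using x(1) finite_clus[OF assms] set_dist_nonneg[OF fin ne]
    by (intro member_le_sum) auto
  finally show "1 \<le> r" using r by simp
next
  obtain z where z: "z \<in> clus i" using clus_nonempty[OF assms] by auto
  define Y where "Y = clus i - {z}"
  have fin: "finite Y" and Yk: "card Y = k" and YV: "Y \<subseteq> V"
    using z finite_clus[OF assms] card_clus[OF assms] by (auto simp: Y_def clus_def)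
  \<comment> \<open>As \<open>k\<close> \<ge> 1, the omitted point \<open>z\<close> still has a
    centre in its own cluster, at distance 1.\<close>
  then obtain y where y: "y \<in> Y" using k_pos by fastforce
  have "set_dist dist_k Y z \<le> 1"
    using set_dist_le[OF fin y, of z] y z by (auto simp: cluster_dist_def Y_def clus_def)
  moreover have "1 \<le> set_dist dist_k Y z"
    using fin y by (intro set_dist_outside_ge_1) (auto simp: Y_def)
  ultimately have "set_dist dist_k Y z = 1" by simp
  then have "cost dist_k (clus i) Y = 1"
    unfolding cost_def using sum.remove[OF finite_clus[OF assms] z, of "set_dist dist_k Y"]
      set_dist_self[OF fin] by (simp flip: Y_def)
  then show "1 \<in> cost dist_k (clus i) ` {Y. Y \<subseteq> V \<and> card Y = k}"
    using YV Yk by force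
qed

lemma rho_clus:
  assumes "i \<le> k"
  shows "rho k V dist_k Y (clus i) = cost dist_k (clus i) Y"
  using opt_clus[OF assms] by (simp add: rho_def)

text \<open>Every centre lies in another cluster, so each of the \<open>k + 1\<close> points pays
  exactly \<open>k\<close>.\<close>

lemma rho_missed:
  assumes "i \<le> k" "finite Y" "Y \<noteq> {}" "Y \<inter> clus i = {}" "Y \<subseteq> V"
  shows "rho k V dist_k Y (clus i) = real (k + 1) * real k"
proof -
  have "set_dist dist_k Y x = real k" if "x \<in> clus i" for x
  proof -
    have "dist_k x y = real k" if "y \<in> Y" for y
      using \<open>x \<in> clus i\<close> that assms(4,5) by (auto simp: cluster_dist_def clus_def)
    then have "dist_k x ` Y = {real k}" using assms(3) by auto
    then show ?thesis by (simp add: set_dist_def)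
  qed
  then have "cost dist_k (clus i) Y = real (k + 1) * real k"
    using card_clus[OF assms(1)] by (simp add: cost_def)
  then show ?thesis using rho_clus[OF assms(1)] by simp
qed

text \<open>The centre \<open>y\<close> pays nothing, and it serves each of the other
  \<open>k\<close> points at distance 1.\<close>

lemma rho_hit_le:
  assumes "i \<le> k" "finite Y" "y \<in> Y" "y \<in> clus i"
  shows "rho k V dist_k Y (clus i) \<le> real k"
proof -
  have "(\<Sum>x \<in> clus i - {y}. set_dist dist_k Y x) \<le> (\<Sum>x \<in> clus i - {y}. 1)"
  proof (rule sum_mono)
    fix x assume "x \<in> clus i - {y}"
    then have "dist_k x y = 1" using assms(4) by (auto simp: cluster_dist_def clus_def)
    then show "set_dist dist_k Y x \<le> 1" using set_dist_le[OF assms(2,3), of x] by simp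
  qed
  also have "\<dots> = real k"
    using card_clus[OF assms(1)] assms(4) finite_clus[OF assms(1)] by simp
  finally have "cost dist_k (clus i) Y \<le> real k"
    unfolding cost_def using sum.remove[OF finite_clus[OF assms(1)] assms(4), of "set_dist dist_k Y"]
      set_dist_self[OF assms(2,3)] by simp
  then show ?thesis using rho_clus[OF assms(1)] by simp
qed

text \<open>Pigeonhole: otherwise \<open>c\<close> would map the \<open>k\<close> points of
  \<open>Y\<close> onto \<open>k + 1\<close> labels.\<close>

lemma missed_cluster:
  assumes "Y \<subseteq> V" "card Y = k"
  shows "\<exists>i\<le>k. Y \<inter> clus i = {}"
proof (rule ccontr)
  assume "\<not> ?thesis"
  then have "\<forall>i\<le>k. \<exists>y\<in>Y. c y = i" by (auto simp: clus_def)
  then have "{..k} \<subseteq> c ` Y" by auto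
  moreover have "finite Y" using assms(1) finite_V finite_subset by blast
  ultimately have "card {..k} \<le> card Y" by (rule surj_card_le[rotated])
  then show False using assms(2) by simp
qed

lemma ex_transversal_avoiding:
  assumes "i \<le> k"
  shows "\<exists>Y. Y \<subseteq> V \<and> card Y = k \<and> Y \<inter> clus i = {} \<and> (\<forall>j\<le>k. j \<noteq> i \<longrightarrow> Y \<inter> clus j \<noteq> {})"
proof -
  define rep where "rep j = (SOME x. x \<in> clus j)" for j
  have rep: "rep j \<in> clus j" if "j \<le> k" for j
    unfolding rep_def using clus_nonempty[OF that] by (rule some_in_eq[THEN iffD2])
  then have crep: "c (rep j) = j" if "j \<le> k" for j
    using that by (auto simp: clus_def)
  have "inj_on rep ({..k} - {i})"
    by (rule inj_on_inverseI[where g = c]) (use crep in auto)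
  then have "card (rep ` ({..k} - {i})) = k"
    using assms by (simp add: card_image)
  then show ?thesis
    using rep crep by (intro exI[of _ "rep ` ({..k} - {i})"]) (auto simp: clus_def)
qed

text \<open>The comparator is chosen in hindsight and leaves out only the cluster presented least
  often.\<close>

lemma ex_good_comparator:
  assumes "\<And>t. t \<in> {1..T} \<Longrightarrow> j t \<le> k"
  shows "\<exists>Y. Y \<subseteq> V \<and> card Y = k \<and>
           (\<Sum>t=1..T. rho k V dist_k Y (clus (j t))) \<le> 2 * real k * real T"
proof -
  obtain i where i: "i \<le> k" and rare: "(k + 1) * card {t \<in> {1..T}. j t = i} \<le> T"
    using ex_rarely_hit[of "{1..T}" j k] assms by auto
  obtain Y where Y: "Y \<subseteq> V" "card Y = k" "Y \<inter> clus i = {}"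
    and hit: "\<And>j. j \<le> k \<Longrightarrow> j \<noteq> i \<Longrightarrow> Y \<inter> clus j \<noteq> {}"
    using ex_transversal_avoiding[OF i] by blast
  have fin: "finite Y" and ne: "Y \<noteq> {}"
    using Y finite_V finite_subset k_pos by auto
  \<comment> \<open>Each step is charged \<open>k\<close>, with a surcharge of
    \<open>(k + 1) * k\<close> when the avoided cluster appears. That happens at most
    \<open>T / (k + 1)\<close> times, so the surcharges add up to at most
    \<open>k * T\<close>.\<close>
  have "(\<Sum>t=1..T. rho k V dist_k Y (clus (j t)))
      \<le> (\<Sum>t=1..T. real k + (if j t = i then real (k + 1) * real k else 0))"
  proof (rule sum_mono)
    fix t assume t: "t \<in> {1..T}"
    show "rho k V dist_k Y (clus (j t)) \<le> real k + (if j t = i then real (k + 1) * real k else 0)"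
    proof (cases "j t = i")
      case True
      then show ?thesis using rho_missed[OF i fin ne Y(3,1)] by simp
    next
      case False
      then obtain y where "y \<in> Y" "y \<in> clus (j t)" using hit assms[OF t] by blast
      then show ?thesis using rho_hit_le[OF assms[OF t] fin] False by simp
    qed
  qed
  also have "\<dots> = real T * real k + real k * real ((k + 1) * card {t \<in> {1..T}. j t = i})"
    by (simp add: sum.distrib sum.If_cases Int_def algebra_simps)
  also have "\<dots> \<le> real T * real k + real k * real T"
    using rare by (intro add_left_mono mult_left_mono) (simp_all only: of_nat_le_iff of_nat_0_le_iff)
  finally show ?thesis using Y by (auto simp: algebra_simps)
qed

section \<open>The adversary and the limit in the horizon\<close>

text \<open>The sequence is infinite and does not depend on a horizon, so the same one serves for
  every \<open>T\<close>.\<close>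

lemma ex_adversary:
  fixes A :: "'a learner"
  assumes "informed_learner A"
  shows "\<exists>j. (\<forall>t. j t \<le> k) \<and>
           (\<forall>t\<ge>1. rho k V dist_k (output_at A k V dist_k (\<lambda>t. clus (j t)) t) (clus (j t))
                    = real (k + 1) * real k)"
proof -
  \<comment> \<open>The implication keeps the label at most \<open>k\<close> even for sets that are
    no legal output. At time 0 the history is empty and the output of \<open>A\<close> is
    unconstrained.\<close>
  define miss where "miss Y = (SOME i. i \<le> k \<and> (Y \<subseteq> V \<and> card Y = k \<longrightarrow> Y \<inter> clus i = {}))" for Y
  have miss: "miss Y \<le> k \<and> (Y \<subseteq> V \<and> card Y = k \<longrightarrow> Y \<inter> clus (miss Y) = {})" for Y
    unfolding miss_def by (rule someI_ex) (use missed_cluster in blast)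
  obtain j where j: "\<And>t. j t = miss (A k V dist_k (map clus (map j [0..<t])))"
    using ex_history_dependent_sequence[of "\<lambda>H. miss (A k V dist_k (map clus H))"] by blast
  have jk: "j t \<le> k" for t using j miss by metis
  have "rho k V dist_k (output_at A k V dist_k (\<lambda>t. clus (j t)) t) (clus (j t))
          = real (k + 1) * real k" if "t \<ge> 1" for t
  proof -
    define H where "H = map (\<lambda>t. clus (j t)) [0..<t]"
    have jt: "j t = miss (A k V dist_k H)"
      using j[of t] by (simp add: H_def comp_def)
    have "valid_history k V H"
      using \<open>t \<ge> 1\<close> median_instance_clus[OF jk] by (auto simp: valid_history_def H_def)
    then have out: "A k V dist_k H \<subseteq> V" "card (A k V dist_k H) = k"
      using assms k_pos scaled_metric_V unfolding informed_learner_def by blast+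
    have "A k V dist_k H \<inter> clus (j t) = {}"
      using miss[of "A k V dist_k H"] out jt by simp
    moreover have "finite (A k V dist_k H)" "A k V dist_k H \<noteq> {}"
      using out finite_V finite_subset k_pos by auto
    ultimately show ?thesis
      using rho_missed[OF jk] out(1) by (simp add: output_at_def H_def)
  qed
  then show ?thesis using jk by blast
qed

lemma alpha_lower_bound:
  fixes A :: "'a learner"
  assumes A: "informed_learner A" and guar: "has_guarantee A \<alpha> g f"
    and \<alpha>: "0 \<le> \<alpha> k" and g: "(\<lambda>T. g T / real T) \<longlonglongrightarrow> 0"
  shows "real (k + 1) \<le> 2 * \<alpha> k"
proof -
  obtain j where jk: "\<And>t. j t \<le> k"
    and alg: "\<And>t. t \<ge> 1 \<Longrightarrow>
      rho k V dist_k (output_at A k V dist_k (\<lambda>t. clus (j t)) t) (clus (j t)) = real (k + 1) * real k"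
    using ex_adversary[OF A] by blast
  \<comment> \<open>The space is fixed while \<open>T\<close> grows, so \<open>C\<close> is a
    constant, and after division by \<open>T\<close> the additive term vanishes in the
    limit.\<close>
  define C where "C = f k (card V) (aspect_ratio V dist_k)"
  have bound: "real (k + 1) * real k \<le> 2 * \<alpha> k * real k + g T / real T * C" if "T \<ge> 1" for T
  proof -
    obtain Y where Y: "Y \<subseteq> V" "card Y = k"
      and le: "(\<Sum>t=1..T. rho k V dist_k Y (clus (j t))) \<le> 2 * real k * real T"
      using ex_good_comparator[of T j] jk by blast
    have "real T * (real (k + 1) * real k)
        = (\<Sum>t=1..T. rho k V dist_k (output_at A k V dist_k (\<lambda>t. clus (j t)) t) (clus (j t)))"
      using alg by simp
    also have "\<dots> \<le> \<alpha> k * (\<Sum>t=1..T. rho k V dist_k Y (clus (j t))) + g T * C"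
      unfolding C_def
      by (rule guar[unfolded has_guarantee_def, rule_format])
        (use k_pos scaled_metric_V median_instance_clus[OF jk] Y in auto)
    also have "\<dots> \<le> \<alpha> k * (2 * real k * real T) + g T * C"
      using le \<alpha> by (intro add_right_mono mult_left_mono)
    finally have "real T * (real (k + 1) * real k) \<le> \<alpha> k * (2 * real k * real T) + g T * C" .
    then have "real T * (real (k + 1) * real k)
        \<le> real T * (2 * \<alpha> k * real k + g T / real T * C)"
      using that by (simp add: algebra_simps)
    then show ?thesis using that by (subst (asm) mult_le_cancel_left_pos) auto
  qed
  have "(\<lambda>T. 2 * \<alpha> k * real k + g T / real T * C) \<longlonglongrightarrow> 2 * \<alpha> k * real k + 0 * C"
    by (intro tendsto_intros g)
  then have "real (k + 1) * real k \<le> 2 * \<alpha> k * real k + 0 * C"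
    by (rule LIMSEQ_le_const) (use bound in blast)
  then show ?thesis using k_pos by simp
qed

end

section \<open>Realisation in an infinite type and conclusion\<close>

text \<open>Points are coded as pairs (cluster, position), embedded through an injection of
  \<open>nat\<close> into \<open>'a\<close>. One type thus hosts the spaces for all
  \<open>k\<close>.\<close>

lemma ex_clustered:
  assumes "1 \<le> k"
  shows "\<exists>(V :: 'a::infinite set) c. clustered k V c"
proof -
  obtain p :: "nat \<Rightarrow> 'a" where p: "inj p"
    using infinite_countable_subset[OF infinite_UNIV] by auto
  define q where "q = (\<lambda>ij. p (prod_encode ij))"
  have q: "inj q"
    unfolding q_def using p by (auto intro!: injI dest!: injD simp: prod_encode_eq)
  define V where "V = q ` ({..k} \<times> {..k})"
  define c where "c x = fst (inv q x)" for x
  have c: "c (q ij) = fst ij" for ij using q by (simp add: c_def)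
  have "{x \<in> V. c x = i} = q ` ({i} \<times> {..k})" if "i \<le> k" for i
    using that by (auto simp: V_def c)
  then have "card {x \<in> V. c x = i} = k + 1" if "i \<le> k" for i
    using that card_image[OF inj_on_subset[OF q]] by (simp add: card_cartesian_product)
  then have "clustered k V c"
    using assms by unfold_locales (auto simp: V_def c)
  then show ?thesis by blast
qed

lemma no_informed_guarantee:
  fixes A :: "'a::infinite learner"
  assumes A: "informed_learner A" and guar: "has_guarantee A \<alpha> g f"
    and \<alpha>: "\<And>k. 0 \<le> \<alpha> k" "(\<lambda>k. \<alpha> k / real k) \<longlonglongrightarrow> 0"
    and g: "(\<lambda>T. g T / real T) \<longlonglongrightarrow> 0"
  shows False
proof -
  \<comment> \<open>The lower bound \<open>(k + 1) / 2\<close> on \<open>\<alpha> k\<close> keeps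
    the quotient at least 1/2 for every \<open>k\<close> \<ge> 1, which contradicts the limit
    0.\<close>
  have "1 / 2 \<le> \<alpha> k / real k" if k: "k \<ge> 1" for k
  proof -
    obtain V :: "'a set" and c where "clustered k V c" using ex_clustered[OF k] by blast
    from clustered.alpha_lower_bound[OF this A guar \<alpha>(1) g]
    show ?thesis using k by (simp add: field_simps)
  qed
  then have "1 / 2 \<le> (0::real)"
    by (intro LIMSEQ_le_const[OF \<alpha>(2)]) blast
  then show False by simp
qed

theorem theorem5:
  shows "(\<nexists>(A :: 'a::infinite learner) \<alpha> g f.
            standard_learner A \<and>
            (\<forall>k. 0 \<le> \<alpha> k) \<and> (\<lambda>k. \<alpha> k / real k) \<longlonglongrightarrow> 0 \<and>
            (\<forall>T. 0 \<le> g T) \<and> (\<lambda>T. g T / real T) \<longlonglongrightarrow> 0 \<and>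
            has_guarantee A \<alpha> g f)
       \<and> (\<nexists>(A :: 'a learner) \<alpha> g f.
            informed_learner A \<and>
            (\<forall>k. 0 \<le> \<alpha> k) \<and> (\<lambda>k. \<alpha> k / real k) \<longlonglongrightarrow> 0 \<and>
            (\<forall>T. 0 \<le> g T) \<and> (\<lambda>T. g T / real T) \<longlonglongrightarrow> 0 \<and>
            has_guarantee A \<alpha> g f)"
  using no_informed_guarantee standard_imp_informed by blast

end
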